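(* Let $G=(V,E)$ be a finite simple undirected graph and let $k\ge 1$ be an integer with $k+1\le |V|$ such that $h_{k+1}(G)/3^{k+1}>h_k(G)$. Then there exists a $k$-partition $\{G^i=(V^i,E^i)\}_{i=1}^k$ of $G$ such that $$\frac{h_{k+1}(G)}{3^{k+1}}\le \min_{i=1,\dots,k} h(G^i)\qquad\text{and}\qquad \max_{i=1,\dots,k}\frac{|\partial V^i|}{|V^i|}\le 3^k h_k(G).$$
   Context: Graphs are finite, undirected, without loops or multiple edges. For $F\subset V$, $\partial F$ denotes the set of edges of $G$ with one endpoint in $F$ and the other in $V\setminus F$. The expansion constant is $h(G)=\min\{ |\partial F|/|F| : F\subset V,\ 1\le |F|\le |V|/2\}$ (taken to be $+\infty$ for a one-vertex graph). For $1\le k\le |V|$, the $k$-way expansion constant is $h_k(G)=\min\{\max_{i=1,\dots,k} |\partial V^i|/|V^i| : V=\bigsqcup_{i=1}^k V^i,\ V^i\neq\emptyset\}$. An induced subgraph $H$ of $G$ has vertex set $V_H\subset V$ and edge set $\{xy\in E: x,y\in V_H\}$. A $k$-partition of $G$ is a family of induced subgraphs $\{G^i=(V^i,E^i)\}_{i=1}^k$ of $G$ with $V$ the disjoint union of the $V^i$; $h(G^i)$ is the expansion constant of $G^i$ as a graph in its own right, while $\partial V^i$ is the edge boundary of $V^i$ in $G$. *)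

theory Defs
  imports "Graph_Theory.Digraph_Component" "HOL-Library.Extended_Real" "HOL-Library.Disjoint_Sets"
begin

text \<open>
  A finite simple undirected graph is an instance of the locale \<^locale>\<open>graph\<close>: a finite,
  symmetric, loop-free digraph without parallel arcs. An undirected edge \<open>{x, y}\<close> is
  thus represented by two opposite arcs; the boundary below collects the edges as unordered
  pairs, so that each of them is counted once.
\<close>

definition edge_boundary :: "('a, 'b) pre_digraph \<Rightarrow> 'a set \<Rightarrow> 'a set set" where
  "edge_boundary G F = {{x, y} | x y. (x, y) \<in> arcs_ends G \<and> x \<in> F \<and> y \<in> verts G - F}"

definition boundary_ratio :: "('a, 'b) pre_digraph \<Rightarrow> 'a set \<Rightarrow> real" where
  "boundary_ratio G F = real (card (edge_boundary G F)) / real (card F)"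

text \<open>
  On a finite graph the infimum ranges over finitely many sets \<open>F\<close>, hence is a minimum,
  unless there is at most one vertex: then it is the infimum of the empty set, \<open>\<infinity>\<close>.
\<close>

definition expansion_const :: "('a, 'b) pre_digraph \<Rightarrow> ereal" where
  "expansion_const G =
     (INF F \<in> {F. F \<subseteq> verts G \<and> 1 \<le> card F \<and> real (card F) \<le> real (card (verts G)) / 2}.
        ereal (boundary_ratio G F))"

definition vertex_partition :: "('a, 'b) pre_digraph \<Rightarrow> nat \<Rightarrow> (nat \<Rightarrow> 'a set) \<Rightarrow> bool" where
  "vertex_partition G k W \<longleftrightarrow>
     (\<Union>i\<in>{1..k}. W i) = verts G \<and> disjoint_family_on W {1..k} \<and> (\<forall>i\<in>{1..k}. W i \<noteq> {})"

text \<open>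
  For a finite graph and \<open>1 \<le> k \<le> |V|\<close> the set of values is finite and nonempty.
\<close>

definition kway_expansion_const :: "('a, 'b) pre_digraph \<Rightarrow> nat \<Rightarrow> real" where
  "kway_expansion_const G k =
     Min {MAX i\<in>{1..k}. boundary_ratio G (W i) | W. vertex_partition G k W}"

text \<open>
  The parts are required to be nonempty, as the quotients \<open>|\<partial>V\<^sup>i| / |V\<^sup>i|\<close> presuppose.
\<close>

definition graph_partition ::
  "('a, 'b) pre_digraph \<Rightarrow> nat \<Rightarrow> (nat \<Rightarrow> ('a, 'b) pre_digraph) \<Rightarrow> bool" where
  "graph_partition G k H \<longleftrightarrow>
     (\<forall>i\<in>{1..k}. induced_subgraph (H i) G) \<and> vertex_partition G k (\<lambda>i. verts (H i))"

end

theory Submission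
  imports Defs
begin

text \<open>
  Write \<open>h = h\<^sub>k\<close>, \<open>D = h\<^sub>k\<^sub>+\<^sub>1\<close> and \<open>c = D / 3 ^ (k + 1)\<close>. Consider partitions \<open>P\<^sub>1, \<dots>, P\<^sub>k\<close> together
  with nonempty cores \<open>C\<^sub>i \<subseteq> P\<^sub>i\<close> satisfying \<open>|\<partial>C\<^sub>i| \<le> h |C\<^sub>i|\<close>; an optimal partition for \<open>h\<^sub>k\<close>,
  being its own system of cores, is an example. Choose the cores with the least total size
  and then the partition with the fewest cut edges. Moving \<open>P\<^sub>i - C\<^sub>i\<close> to another part does not
  reduce the cut, which gives \<open>|\<partial>P\<^sub>i| \<le> (k + 1) h |P\<^sub>i|\<close>. Suppose that \<open>A \<subseteq> P\<^sub>i\<close> with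
  \<open>|A| \<le> |P\<^sub>i| / 2\<close> has fewer than \<open>c |A|\<close> edges to \<open>P\<^sub>i - A\<close>. In the partition into \<open>k + 1\<close> sets that
  splits \<open>A\<close> off, all other parts have ratio below \<open>D\<close>, so \<open>|\<partial>A| \<ge> D |A|\<close>. Moving \<open>A - C\<^sub>i\<close> to
  another part does not reduce the cut either, so most of these edges are accounted for by
  \<open>A \<inter> C\<^sub>i\<close>. Hence \<open>|\<partial>(C\<^sub>i - A)| < |\<partial>C\<^sub>i| - h |A|\<close>, and \<open>C\<^sub>i - A\<close> is a smaller core. Only
  \<open>D \<ge> (2 k + 3) c\<close> is needed, and the boundary bound is linear in \<open>k\<close>.
\<close>

section \<open>Counting edges between vertex sets\<close>

text \<open>For disjoint \<open>S\<close> and \<open>T\<close> each undirected edge between them is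
  counted once, since only one of its orientations lies in \<open>S \<times> T\<close>. Real values
  make subtraction of counts safe.\<close>

definition edges_between :: "('a \<times> 'a) set \<Rightarrow> 'a set \<Rightarrow> 'a set \<Rightarrow> real" where
  "edges_between E S T = real (card (E \<inter> S \<times> T))"

text \<open>Partitions are handled as labellings: disjointness is automatic, and moving vertices is
  a pointwise change of \<open>f\<close>.\<close>

definition part :: "'a set \<Rightarrow> ('a \<Rightarrow> nat) \<Rightarrow> nat \<Rightarrow> 'a set" where
  "part V f i = {v \<in> V. f v = i}"

text \<open>Every undirected cut edge occurs twice, once in each orientation.\<close>
definition cut_arcs :: "('a \<times> 'a) set \<Rightarrow> ('a \<Rightarrow> nat) \<Rightarrow> ('a \<times> 'a) set" where
  "cut_arcs E f = {(x, y) \<in> E. f x \<noteq> f y}"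

locale finite_sym_rel =
  fixes V :: "'a set" and E :: "('a \<times> 'a) set"
  assumes finV: "finite V" and EV: "E \<subseteq> V \<times> V" and symE: "sym E"
begin

abbreviation e where "e \<equiv> edges_between E"
abbreviation P where "P \<equiv> part V"

lemma finE: "finite E"
  using finV EV by (meson finite_SigmaI finite_subset)

lemma finite_part [simp]: "finite (P f i)"
  using finV by (simp add: part_def)

lemma e_nonneg [simp]: "0 \<le> e S T"
  by (simp add: edges_between_def)

lemma e_empty [simp]: "e {} T = 0" "e S {} = 0"
  by (simp_all add: edges_between_def)

lemma e_commute: "e S T = e T S"
proof -
  have "E \<inter> T \<times> S = (E \<inter> S \<times> T)\<inverse>"
    using symE by (auto simp: sym_def)
  then show ?thesis
    by (simp add: edges_between_def)
qed

lemma e_mono: "S \<subseteq> S' \<Longrightarrow> T \<subseteq> T' \<Longrightarrow> e S T \<le> e S' T'"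
  unfolding edges_between_def using finE
  by (intro of_nat_mono card_mono) auto

lemma e_Un_right: "T \<inter> T' = {} \<Longrightarrow> e S (T \<union> T') = e S T + e S T'"
proof -
  assume *: "T \<inter> T' = {}"
  have "E \<inter> S \<times> (T \<union> T') = (E \<inter> S \<times> T) \<union> (E \<inter> S \<times> T')" by auto
  moreover have "(E \<inter> S \<times> T) \<inter> (E \<inter> S \<times> T') = {}" using * by auto
  ultimately show ?thesis
    using finE by (simp add: edges_between_def card_Un_disjoint)
qed

lemma e_Un_left: "S \<inter> S' = {} \<Longrightarrow> e (S \<union> S') T = e S T + e S' T"
  using e_Un_right[of S S' T] by (simp add: e_commute)

lemma e_UN_right:
  assumes "finite J" "disjoint_family_on T J"
  shows "e S (\<Union>j\<in>J. T j) = (\<Sum>j\<in>J. e S (T j))"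
  using assms
proof (induction J rule: finite_induct)
  case (insert j J)
  have "T j \<inter> (\<Union>j\<in>J. T j) = {}"
    using insert.prems insert.hyps by (auto simp: disjoint_family_on_def)
  moreover have "disjoint_family_on T J"
    using insert.prems by (auto simp: disjoint_family_on_def)
  ultimately show ?case
    using insert by (simp add: e_Un_right)
qed simp

lemma e_outside_part_le:
  assumes f: "f \<in> V \<rightarrow> {1..k}" and i: "i \<in> {1..k}" and m: "0 \<le> m"
    and le: "\<And>j. j \<in> {1..k} \<Longrightarrow> j \<noteq> i \<Longrightarrow> e S (P f j) \<le> m"
  shows "e S (V - P f i) \<le> real k * m"
proof -
  have "V - P f i = (\<Union>j\<in>{1..k} - {i}. P f j)"
    using f by (auto simp: part_def)
  then have "e S (V - P f i) = (\<Sum>j\<in>{1..k} - {i}. e S (P f j))"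
    by (simp only:) (rule e_UN_right, auto simp: disjoint_family_on_def part_def)
  also have "\<dots> \<le> (\<Sum>j\<in>{1..k} - {i}. m)"
    by (intro sum_mono) (use le in auto)
  also have "\<dots> \<le> real k * m"
    using i m by (auto intro!: mult_right_mono)
  finally show ?thesis .
qed

section \<open>Cut size under relabelling\<close>

lemma finite_cut_arcs [simp]: "finite (cut_arcs E f)"
  using finE by (auto simp: cut_arcs_def intro: finite_subset)

text \<open>A cut arc meeting \<open>A\<close> joins \<open>A\<close> to a differently labelled
  vertex outside, in either orientation. Isolating the arcs that avoid \<open>A\<close> lets
  labellings that differ only on \<open>A\<close> be compared.\<close>

lemma card_cut_arcs_const_on:
  assumes A: "A \<subseteq> V" and g: "\<And>v. v \<in> A \<Longrightarrow> g v = a"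
  shows "real (card (cut_arcs E g)) + 2 * e A {v \<in> V - A. g v = a}
       = real (card {(x, y) \<in> E. x \<notin> A \<and> y \<notin> A \<and> g x \<noteq> g y}) + 2 * e A (V - A)"
proof -
  let ?X = "{(x, y) \<in> E. x \<notin> A \<and> y \<notin> A \<and> g x \<noteq> g y}"
  let ?D = "{v \<in> V - A. g v \<noteq> a}"
  have eq: "cut_arcs E g = (?X \<union> E \<inter> A \<times> ?D) \<union> E \<inter> ?D \<times> A"
  proof (rule set_eqI)
    fix p show "p \<in> cut_arcs E g \<longleftrightarrow> p \<in> (?X \<union> E \<inter> A \<times> ?D) \<union> E \<inter> ?D \<times> A"
      using EV by (cases p; cases "fst p \<in> A"; cases "snd p \<in> A")
        (auto simp: cut_arcs_def dest: g)
  qed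
  have fin: "finite ?X" "finite (E \<inter> A \<times> ?D)" "finite (E \<inter> ?D \<times> A)"
    using finE by (auto intro: finite_subset)
  have "card (cut_arcs E g) = card ?X + card (E \<inter> A \<times> ?D) + card (E \<inter> ?D \<times> A)"
    unfolding eq using fin
    by (subst card_Un_disjoint, simp, simp, force, subst card_Un_disjoint) auto
  then have "real (card (cut_arcs E g)) = real (card ?X) + e A ?D + e ?D A"
    by (simp add: edges_between_def)
  moreover have "e A (V - A) = e A {v \<in> V - A. g v = a} + e A ?D"
    by (subst e_Un_right[symmetric]) (auto intro: arg_cong[where f = "e A"])
  ultimately show ?thesis
    using e_commute[of ?D A] by linarith
qed

text \<open>Both labellings have the same right-hand side in the preceding identity, because they
  agree off \<open>A\<close>.\<close>

lemma card_cut_arcs_relabel: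
  assumes A: "A \<subseteq> P f i" and ij: "j \<noteq> i"
  shows "real (card (cut_arcs E (\<lambda>v. if v \<in> A then j else f v))) + 2 * e A (P f j)
       = real (card (cut_arcs E f)) + 2 * e A (P f i - A)"
proof -
  let ?g = "\<lambda>v. if v \<in> A then j else f v"
  have AV: "A \<subseteq> V" using A by (auto simp: part_def)
  have 1: "{v \<in> V - A. ?g v = j} = P f j" "{v \<in> V - A. f v = i} = P f i - A"
    using A ij by (auto simp: part_def)
  have 2: "{(x, y) \<in> E. x \<notin> A \<and> y \<notin> A \<and> ?g x \<noteq> ?g y}
      = {(x, y) \<in> E. x \<notin> A \<and> y \<notin> A \<and> f x \<noteq> f y}" by auto
  have "f v = i" if "v \<in> A" for v using A that by (auto simp: part_def)
  then show ?thesis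
    using card_cut_arcs_const_on[OF AV, of ?g j] card_cut_arcs_const_on[OF AV, of f i]
    unfolding 1 2 by simp
qed

section \<open>The extremal argument\<close>

text \<open>The hypotheses on \<open>f0\<close> express that the \<open>k\<close>-way constant is at
  most \<open>h\<close>, and \<open>refine\<close> that the \<open>(k + 1)\<close>-way constant is
  at least \<open>D\<close>, both with denominators cleared.\<close>

theorem expander_partition:
  fixes c h D :: real
  assumes h: "0 \<le> h" "h < c" and D: "real (2 * k + 3) * c \<le> D"
    and f0: "f0 \<in> V \<rightarrow> {1..k}" "\<And>i. i \<in> {1..k} \<Longrightarrow> P f0 i \<noteq> {}"
      "\<And>i. i \<in> {1..k} \<Longrightarrow> e (P f0 i) (V - P f0 i) \<le> h * card (P f0 i)"
    and refine: "\<And>g. g \<in> V \<rightarrow> {1..k + 1} \<Longrightarrow> (\<forall>i\<in>{1..k + 1}. P g i \<noteq> {}) \<Longrightarrow>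
      \<exists>i\<in>{1..k + 1}. D * card (P g i) \<le> e (P g i) (V - P g i)"
  obtains f where "f \<in> V \<rightarrow> {1..k}" "\<And>i. i \<in> {1..k} \<Longrightarrow> P f i \<noteq> {}"
    "\<And>i. i \<in> {1..k} \<Longrightarrow> e (P f i) (V - P f i) \<le> real (k + 1) * h * card (P f i)"
    "\<And>i A. i \<in> {1..k} \<Longrightarrow> A \<subseteq> P f i \<Longrightarrow> A \<noteq> {} \<Longrightarrow> 2 * card A \<le> card (P f i) \<Longrightarrow>
      c * card A \<le> e A (P f i - A)"
proof -
  \<comment> \<open>The boundary of a core is taken in all of \<open>V\<close>, so it does not
    depend on \<open>f\<close>: the partition can vary while the cores stay fixed.\<close>
  define adm where "adm C f \<longleftrightarrow> f \<in> V \<rightarrow> {1..k} \<and> (\<forall>i\<in>{1..k}. C i \<noteq> {} \<and> C i \<subseteq> P f i \<and>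
    e (C i) (V - C i) \<le> h * card (C i))" for C :: "nat \<Rightarrow> 'a set" and f
  define tot where "tot C = (\<Sum>i\<in>{1..k}. card (C i))" for C :: "nat \<Rightarrow> 'a set"
  have "\<exists>C. \<exists>f. adm C f"
    using f0 by (intro exI[of _ "P f0"] exI[of _ f0]) (auto simp: adm_def)
  then obtain C where exf: "\<exists>f. adm C f" and Cmin: "\<And>C' f. adm C' f \<Longrightarrow> tot C \<le> tot C'"
    using ex_has_least_nat[of "\<lambda>C. \<exists>f. adm C f" _ tot] by blast
  from exf obtain f where adm: "adm C f"
    and fmin: "\<And>f'. adm C f' \<Longrightarrow> card (cut_arcs E f) \<le> card (cut_arcs E f')"
    using ex_has_least_nat[of "adm C" _ "\<lambda>f. card (cut_arcs E f)"] by blast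
  have f: "f \<in> V \<rightarrow> {1..k}" using adm by (simp add: adm_def)
  have C: "C i \<noteq> {}" "C i \<subseteq> P f i" "e (C i) (V - C i) \<le> h * card (C i)" if "i \<in> {1..k}" for i
    using adm that by (auto simp: adm_def)
  have PV: "P f i \<subseteq> V" for i by (auto simp: part_def)
  \<comment> \<open>Since \<open>A\<close> avoids the core, relabelling it keeps \<open>C\<close>
    admissible, and the minimality of the cut under \<open>f\<close> applies.\<close>
  have move: "e A (P f j) \<le> e A (P f i - A)"
    if i: "i \<in> {1..k}" and j: "j \<in> {1..k}" "j \<noteq> i" and A: "A \<subseteq> P f i - C i" for i j A
  proof -
    let ?g = "\<lambda>v. if v \<in> A then j else f v"
    have "C l \<subseteq> P ?g l" if "l \<in> {1..k}" for l
      using C(2)[OF that] A by (auto simp: part_def)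
    then have "adm C ?g"
      using adm j by (auto simp: adm_def)
    moreover have "A \<subseteq> P f i" using A by auto
    ultimately show ?thesis
      using fmin[of ?g] card_cut_arcs_relabel[of A f i j] j by simp
  qed
  have out: "e A (V - P f i) \<le> real k * e A (P f i - A)"
    if i: "i \<in> {1..k}" and A: "A \<subseteq> P f i - C i" for i A
    using e_outside_part_le[OF f i] move[OF i _ _ A] by simp
  have bound: "e (P f i) (V - P f i) \<le> real (k + 1) * h * card (P f i)" if i: "i \<in> {1..k}" for i
  proof -
    \<comment> \<open>Inside the part, all edges leaving \<open>?Q\<close> end in the core, so they
      are boundary edges of \<open>C i\<close> and are controlled by \<open>h\<close>.\<close>
    let ?Q = "P f i - C i"
    have Q: "P f i - ?Q = C i" using C(2)[OF i] by auto
    have "P f i = C i \<union> ?Q" using C(2)[OF i] by auto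
    then have "e (P f i) (V - P f i) = e (C i) (V - P f i) + e ?Q (V - P f i)"
      using e_Un_left[of "C i" ?Q "V - P f i"] by auto
    also have "\<dots> \<le> e (C i) (V - C i) + real k * e (C i) (V - C i)"
    proof (rule add_mono)
      show "e (C i) (V - P f i) \<le> e (C i) (V - C i)"
        using C(2)[OF i] by (intro e_mono) auto
      have "e ?Q (V - P f i) \<le> real k * e ?Q (C i)"
        using out[OF i, of ?Q] unfolding Q by simp
      also have "e ?Q (C i) \<le> e (C i) (V - C i)"
        unfolding e_commute[of ?Q] using PV by (intro e_mono) auto
      finally show "e ?Q (V - P f i) \<le> real k * e (C i) (V - C i)"
        by (simp add: mult_left_mono)
    qed
    also have "\<dots> = real (k + 1) * e (C i) (V - C i)" by (simp add: algebra_simps)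
    also have "\<dots> \<le> real (k + 1) * (h * card (C i))"
      using C(3)[OF i] by (intro mult_left_mono) auto
    also have "\<dots> \<le> real (k + 1) * (h * card (P f i))"
      using C(2)[OF i] h by (intro mult_left_mono of_nat_mono card_mono) auto
    finally show ?thesis by (simp add: mult.assoc)
  qed
  have expand: "c * card A \<le> e A (P f i - A)"
    if i: "i \<in> {1..k}" and A: "A \<subseteq> P f i" "A \<noteq> {}" "2 * card A \<le> card (P f i)" for i A
  proof (rule ccontr)
    assume "\<not> c * card A \<le> e A (P f i - A)"
    then have sparse: "e A (P f i - A) < c * card A" by simp
    have finA: "finite A" using A(1) finite_part finite_subset by blast
    have a: "0 < card A" using A(2) finA by (simp add: card_gt_0_iff)
    let ?B = "P f i - A"
    let ?O = "V - P f i"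
    have cardP: "card (P f i) = card A + card ?B"
      using A(1) finA by (simp add: card_Diff_subset card_mono)
    have Bpos: "0 < card ?B" and AB: "card A \<le> card ?B" using cardP A(3) a by auto
    \<comment> \<open>Give \<open>A\<close> the fresh label \<open>k + 1\<close>. Some part of the
      refined partition has ratio at least \<open>D\<close>; the remainder \<open>?B\<close> and the
      untouched parts are excluded.\<close>
    have heavy: "D * card A \<le> e A (V - A)"
    proof -
      let ?g = "\<lambda>v. if v \<in> A then k + 1 else f v"
      have "f v \<noteq> k + 1" if "v \<in> V" for v
        using funcset_mem[OF f that] by auto
      then have gA: "P ?g (k + 1) = A"
        using A(1) by (auto simp: part_def)
      have gB: "P ?g i = ?B"
        using i by (auto simp: part_def)
      have gj: "P ?g j = P f j" if "j \<in> {1..k}" "j \<noteq> i" for j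
        using A(1) that by (auto simp: part_def)
      have ne: "P f j \<noteq> {}" if "j \<in> {1..k}" for j
        using C(1,2)[OF that] by auto
      have cases: "j = k + 1 \<or> j = i \<or> j \<in> {1..k} \<and> j \<noteq> i" if "j \<in> {1..k + 1}" for j
        using that by auto
      have "P ?g j \<noteq> {}" if "j \<in> {1..k + 1}" for j
        using cases[OF that] gA gB gj ne A(2) Bpos by (metis card.empty less_irrefl)
      moreover have "?g \<in> V \<rightarrow> {1..k + 1}" using f by (auto simp: Pi_iff le_SucI)
      ultimately obtain j where j: "j \<in> {1..k + 1}"
        and le: "D * card (P ?g j) \<le> e (P ?g j) (V - P ?g j)"
        using refine[of ?g] by blast
      \<comment> \<open>The first inequality excludes the untouched parts, the second excludes
        \<open>?B\<close>; the latter is where \<open>2 * k + 3\<close> comes from.\<close>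
      have D': "real (k + 1) * c < D" "2 * (real (k + 1) * c) + c \<le> D"
      proof -
        have c: "0 < c" "0 \<le> real k * c" using h by simp_all
        have D3: "2 * (real k * c) + 3 * c \<le> D"
          using D by (simp add: distrib_right)
        have k1: "real (k + 1) * c = real k * c + c" by (simp add: distrib_right)
        show "real (k + 1) * c < D" unfolding k1 using D3 c by linarith
        show "2 * (real (k + 1) * c) + c \<le> D" unfolding k1 using D3 by (simp add: distrib_left)
      qed
      have hc: "real (k + 1) * h \<le> real (k + 1) * c" using h by (intro mult_left_mono) auto
      from cases[OF j] show ?thesis
      proof (elim disjE conjE)
        assume "j = k + 1" then show ?thesis using le gA by simp
      next
        assume ji: "j = i"
        have "V - ?B = ?O \<union> A" using A(1) PV[of i] by auto
        then have "e ?B (V - ?B) = e ?B ?O + e ?B A"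
          using A(1) by (subst e_Un_right[symmetric]) auto
        also have "\<dots> \<le> e (P f i) ?O + e A ?B"
          by (simp add: e_commute[of ?B A] e_mono)
        also have "\<dots> < real (k + 1) * h * card (P f i) + c * card A"
          using bound[OF i] sparse by linarith
        \<comment> \<open>As \<open>A\<close> is at most half of the part,
          \<open>card (P f i)\<close> is at most twice \<open>card ?B\<close>.\<close>
        also have "\<dots> \<le> (real (k + 1) * c) * (2 * real (card ?B)) + c * real (card ?B)"
          using h cardP AB hc by (intro add_mono mult_mono) auto
        also have "\<dots> = (2 * (real (k + 1) * c) + c) * real (card ?B)"
          by (simp add: algebra_simps)
        also have "\<dots> \<le> D * real (card ?B)"
          using D'(2) by (intro mult_right_mono) auto
        finally show ?thesis using le ji gB by simp
      next
        assume jk: "j \<in> {1..k}" "j \<noteq> i"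
        have "e (P f j) (V - P f j) \<le> real (k + 1) * h * card (P f j)" by (rule bound[OF jk(1)])
        also have "\<dots> < D * card (P f j)"
          using le_less_trans[OF hc D'(1)] ne[OF jk(1)]
          by (intro mult_strict_right_mono) (simp_all add: card_gt_0_iff)
        finally show ?thesis using le gj[OF jk] by simp
      qed
    qed
    let ?A1 = "A \<inter> C i" and ?A2 = "A - C i" and ?C' = "C i - A"
    have A12: "A = ?A1 \<union> ?A2" by auto
    have Ci: "C i \<subseteq> P f i" by (rule C(2)[OF i])
    have "V - A = ?B \<union> ?O" using A(1) PV[of i] by auto
    then have s1: "e A (V - A) = e A ?B + e A ?O"
      by (subst e_Un_right[symmetric]) auto
    have s2: "e A ?O = e ?A1 ?O + e ?A2 ?O" "e A ?B = e ?A1 ?B + e ?A2 ?B"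
      using A12 e_Un_left[of ?A1 ?A2] by (metis Diff_disjoint Int_Diff inf_commute)+
    have "P f i - ?A2 = ?A1 \<union> ?B" using A(1) Ci by auto
    then have s3: "e ?A2 (P f i - ?A2) = e ?A1 ?A2 + e ?A2 ?B"
      by (subst e_commute[of ?A1], subst e_Un_right[symmetric]) auto
    \<comment> \<open>\<open>?A2\<close> misses the core, so \<open>out\<close> applies to it; its
      complement in the part is \<open>?A1 \<union> ?B\<close>.\<close>
    have s4: "e ?A2 ?O \<le> real k * (e ?A1 ?A2 + e ?A2 ?B)"
      using out[OF i, of ?A2] A(1) s3 by auto
    have "C i = ?A1 \<union> ?C'" by auto
    then have s5: "e (C i) (V - C i) = e ?A1 (V - C i) + e ?C' (V - C i)"
      using e_Un_left[of ?A1 ?C' "V - C i"] by auto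
    have "V - ?C' = (V - C i) \<union> ?A1" using A(1) PV[of i] by auto
    then have s6: "e ?C' (V - ?C') = e ?C' (V - C i) + e ?A1 ?C'"
      by (subst e_commute[of ?A1], subst e_Un_right[symmetric]) auto
    \<comment> \<open>Removing \<open>?A1\<close> from the core deletes its edges to
      \<open>V - C i\<close> from the boundary and adds its edges to \<open>?C'\<close>.\<close>
    have "e ?A1 (?O \<union> ?A2) \<le> e ?A1 (V - C i)"
      using A(1) Ci PV[of i] by (intro e_mono) auto
    moreover have "e ?A1 (?O \<union> ?A2) = e ?A1 ?O + e ?A1 ?A2"
      using A(1) by (intro e_Un_right) auto
    moreover have "e ?A1 ?C' \<le> e ?A1 ?B"
      using Ci by (intro e_mono) auto
    ultimately have shrink: "e ?C' (V - ?C') \<le> e (C i) (V - C i) - (e ?A1 ?O + e ?A1 ?A2 - e ?A1 ?B)"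
      using s5 s6 by linarith
    \<comment> \<open>a lower bound for the decrease of the boundary when \<open>C i\<close> shrinks to \<open>C i - A\<close>\<close>
    define drop where "drop = e ?A1 ?O + e ?A1 ?A2 - e ?A1 ?B"
    have k: "1 \<le> real k" using i by auto
    have drop: "c * card A < drop"
    proof -
      have "real (2 * k + 3) * c * card A \<le> D * card A"
        using D by (intro mult_right_mono) auto
      also have "\<dots> \<le> e A ?B + e ?A1 ?O + real k * (e ?A1 ?A2 + e ?A2 ?B)"
        using heavy s1 s2 s4 by linarith
      \<comment> \<open>The factor \<open>k\<close> is inserted so that the terms at
        \<open>?A1\<close> combine into \<open>k * drop\<close>.\<close>
      also have "\<dots> \<le> e A ?B + real k * e ?A1 ?O + real k * (e ?A1 ?A2 + e ?A2 ?B)"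
        using k mult_right_mono[OF k e_nonneg[of ?A1 ?O]] by simp
      also have "\<dots> = real (k + 1) * e A ?B + real k * drop"
        using s2 by (simp add: drop_def algebra_simps)
      also have "\<dots> \<le> real (k + 1) * (c * card A) + real k * drop"
        using sparse by (intro add_mono mult_left_mono) auto
      \<comment> \<open>Of the \<open>2 * k + 3\<close> multiples of \<open>c * card A\<close>,
        sparsity of \<open>A\<close> uses up \<open>k + 1\<close>. The remaining
        \<open>k + 2\<close> exceed \<open>k\<close>, which makes the bound on \<open>drop\<close>
        strict.\<close>
      finally have "real k * (c * card A) + 2 * (c * card A) \<le> real k * drop"
        by (simp add: algebra_simps)
      moreover have "0 < c * card A" using h a by simp
      ultimately have "real k * (c * card A) < real k * drop" by linarith
      then show ?thesis using k by (simp add: mult_less_cancel_left)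
    qed
    have "0 \<le> c * card A" using h by simp
    then have pos: "0 < drop" using drop by linarith
    have finC: "finite (C i)" using Ci finite_part finite_subset by blast
    have card1: "card ?C' + card ?A1 = card (C i)"
      using finC by (metis Int_commute add.commute card_Int_Diff)
    have "h * card ?A1 \<le> c * card A"
      using h finA by (intro mult_mono) (auto intro: card_mono)
    then have "e ?C' (V - ?C') < h * card (C i) - h * card ?A1"
      using shrink drop C(3)[OF i] by (simp add: drop_def)
    also have "\<dots> = h * card ?C'" by (simp flip: card1 add: algebra_simps)
    finally have small: "e ?C' (V - ?C') < h * card ?C'" .
    \<comment> \<open>Strictness matters: an empty \<open>?C'\<close> would give
      \<open>0 < 0\<close>.\<close>
    then have ne: "?C' \<noteq> {}"
      using e_nonneg[of ?C' "V - ?C'"] by (metis card.empty mult_zero_right not_le of_nat_0)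
    have "adm (C(i := ?C')) f"
      using adm small ne by (auto simp: adm_def)
    from Cmin[OF this] have "tot C \<le> tot (C(i := ?C'))" .
    moreover have "tot C' = card (C' i) + (\<Sum>j\<in>{1..k} - {i}. card (C' j))" for C'
      unfolding tot_def using i by (simp only: sum.remove finite_atLeastAtMost)
    ultimately have "card (C i) \<le> card ?C'" by simp
    \<comment> \<open>This also covers an \<open>A\<close> that misses the core: with
      \<open>?C' = C i\<close>, \<open>shrink\<close> forces \<open>drop \<le> 0\<close>.\<close>
    then have "?C' = C i"
      using finC by (metis Diff_subset card_seteq)
    then show False
      using shrink pos by (simp add: drop_def)
  qed
  show thesis
    using that[of f] f C(1,2) bound expand by (metis subset_empty)
qed

end

section \<open>Translation to graphs and indexed partitions\<close>

text \<open>Membership in \<open>F\<close> tells the two ends of a boundary edge apart, so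
  forgetting the orientation is injective here.\<close>

lemma card_edge_boundary:
  assumes "F \<subseteq> verts G"
  shows "real (card (edge_boundary G F)) = edges_between (arcs_ends G) F (verts G - F)"
proof -
  let ?S = "arcs_ends G \<inter> F \<times> (verts G - F)"
  have "edge_boundary G F = (\<lambda>(x, y). {x, y}) ` ?S"
    by (auto simp: edge_boundary_def)
  moreover have "inj_on (\<lambda>(x, y). {x, y}) ?S"
    using assms by (auto simp: inj_on_def doubleton_eq_iff)
  ultimately show ?thesis
    by (simp add: edges_between_def card_image)
qed

lemma arcs_ends_induce_subgraph:
  "arcs_ends (G \<restriction> S) = arcs_ends G \<inter> S \<times> S"
  by (auto simp: arcs_ends_def arc_to_ends_def induce_subgraph_def)

lemma vertex_partition_part:
  assumes "g \<in> verts G \<rightarrow> {1..k}" "\<forall>i\<in>{1..k}. part (verts G) g i \<noteq> {}"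
  shows "vertex_partition G k (part (verts G) g)"
  using assms by (auto simp: vertex_partition_def part_def disjoint_family_on_def)

text \<open>Covering gives every vertex a label; disjointness makes that label unique.\<close>

lemma vertex_partition_obtains_label:
  assumes "vertex_partition G k W"
  obtains f where "f \<in> verts G \<rightarrow> {1..k}" "\<And>i. i \<in> {1..k} \<Longrightarrow> part (verts G) f i = W i"
proof -
  have "\<forall>v\<in>verts G. \<exists>i\<in>{1..k}. v \<in> W i"
    using assms by (auto simp: vertex_partition_def)
  then obtain f where f: "\<And>v. v \<in> verts G \<Longrightarrow> f v \<in> {1..k} \<and> v \<in> W (f v)"
    by metis
  have "part (verts G) f i = W i" if i: "i \<in> {1..k}" for i
  proof
    show "part (verts G) f i \<subseteq> W i" using f by (auto simp: part_def)
    show "W i \<subseteq> part (verts G) f i"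
    proof
      fix v assume v: "v \<in> W i"
      then have vG: "v \<in> verts G" using assms i by (auto simp: vertex_partition_def)
      have "f v = i"
        using f[OF vG] v i assms unfolding vertex_partition_def disjoint_family_on_def by blast
      then show "v \<in> part (verts G) f i" using vG by (simp add: part_def)
    qed
  qed
  with f show thesis by (intro that[of f]) auto
qed

lemma vertex_partition_exists:
  assumes "finite (verts G)" "1 \<le> k" "k \<le> card (verts G)"
  shows "\<exists>W. vertex_partition G k W"
proof -
  obtain b where b: "bij_betw b (verts G) {1..card (verts G)}"
    using finite_same_card_bij[OF assms(1), of "{1..card (verts G)}"] by auto
  \<comment> \<open>Enumerate the vertices and merge all positions from \<open>k\<close> on into the
    last class.\<close>
  define g where "g v = min k (b v)" for v
  have "g \<in> verts G \<rightarrow> {1..k}"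
    using b assms(2) by (auto simp: g_def bij_betw_def)
  moreover have "part (verts G) g i \<noteq> {}" if i: "i \<in> {1..k}" for i
  proof -
    have "i \<in> b ` verts G" using i b assms(3) by (auto simp: bij_betw_def)
    then show ?thesis using i by (auto simp: part_def g_def)
  qed
  ultimately show ?thesis using vertex_partition_part by blast
qed

section \<open>The \<open>k\<close>-way constant as an attained minimum\<close>

text \<open>There are infinitely many index functions \<open>W\<close>, but each maximum is attained
  and is thus the ratio of one of finitely many vertex sets.\<close>

lemma finite_kway_values:
  assumes "finite (verts G)" "1 \<le> k"
  shows "finite {MAX i\<in>{1..k}. boundary_ratio G (W i) | W. vertex_partition G k W}"
proof (rule finite_subset)
  show "finite (boundary_ratio G ` Pow (verts G))" using assms by simp
  show "{MAX i\<in>{1..k}. boundary_ratio G (W i) | W. vertex_partition G k W}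
      \<subseteq> boundary_ratio G ` Pow (verts G)"
  proof clarify
    fix W assume W: "vertex_partition G k W"
    have "(MAX i\<in>{1..k}. boundary_ratio G (W i)) \<in> (\<lambda>i. boundary_ratio G (W i)) ` {1..k}"
      using assms(2) by (intro Max_in) auto
    then show "(MAX i\<in>{1..k}. boundary_ratio G (W i)) \<in> boundary_ratio G ` Pow (verts G)"
      using W by (auto simp: vertex_partition_def)
  qed
qed

lemma kway_expansion_const_le:
  assumes "finite (verts G)" "1 \<le> k" "vertex_partition G k W"
  shows "\<exists>i\<in>{1..k}. kway_expansion_const G k \<le> boundary_ratio G (W i)"
proof -
  have "kway_expansion_const G k \<le> (MAX i\<in>{1..k}. boundary_ratio G (W i))"
    unfolding kway_expansion_const_def using assms finite_kway_values
    by (intro Min_le) auto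
  moreover have "(MAX i\<in>{1..k}. boundary_ratio G (W i)) \<in> (\<lambda>i. boundary_ratio G (W i)) ` {1..k}"
    using assms(2) by (intro Max_in) auto
  ultimately show ?thesis by auto
qed

lemma kway_expansion_const_attained:
  assumes "finite (verts G)" "1 \<le> k" "k \<le> card (verts G)"
  obtains W where "vertex_partition G k W"
    "\<And>i. i \<in> {1..k} \<Longrightarrow> boundary_ratio G (W i) \<le> kway_expansion_const G k"
proof -
  let ?M = "{MAX i\<in>{1..k}. boundary_ratio G (W i) | W. vertex_partition G k W}"
  have "Min ?M \<in> ?M"
    using finite_kway_values[OF assms(1,2)] vertex_partition_exists[OF assms] by (intro Min_in) auto
  then obtain W where "vertex_partition G k W"
    "kway_expansion_const G k = (MAX i\<in>{1..k}. boundary_ratio G (W i))"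
    unfolding kway_expansion_const_def by auto
  then show thesis by (intro that[of W]) auto
qed

section \<open>From linear factors to powers of three\<close>

lemma linear_le_power3: "1 \<le> k \<Longrightarrow> k + 1 \<le> 3 ^ k" for k :: nat
  by (induction k rule: nat_induct_at_least) auto

theorem theorem1:
  fixes G :: "('a, 'b) pre_digraph" and k :: nat
  assumes "graph G"
    and "k \<ge> 1" and "k + 1 \<le> card (verts G)"
    and "kway_expansion_const G (k + 1) / 3 ^ (k + 1) > kway_expansion_const G k"
  shows "\<exists>H. graph_partition G k H \<and>
    ereal (kway_expansion_const G (k + 1) / 3 ^ (k + 1))
      \<le> (MIN i\<in>{1..k}. expansion_const (H i)) \<and>
    (MAX i\<in>{1..k}. boundary_ratio G (verts (H i))) \<le> 3 ^ k * kway_expansion_const G k"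
proof -
  interpret graph G by (rule assms(1))
  let ?V = "verts G" and ?E = "arcs_ends G"
  let ?h = "kway_expansion_const G k" and ?D = "kway_expansion_const G (k + 1)"
  let ?c = "?D / 3 ^ (k + 1)"
  interpret R: finite_sym_rel ?V ?E
    using sym_arcs by unfold_locales (auto simp: symmetric_def arcs_ends_def arc_to_ends_def)
  have ratio: "boundary_ratio G S = edges_between ?E S (?V - S) / card S" if "S \<subseteq> ?V" for S
    using card_edge_boundary[OF that] by (simp add: boundary_ratio_def)
  have cardpos: "0 < real (card S)" if "S \<subseteq> ?V" "S \<noteq> {}" for S
    using that finite_subset[OF that(1)] by (simp add: card_gt_0_iff)
  obtain W where W: "vertex_partition G k W"
    and Wh: "\<And>i. i \<in> {1..k} \<Longrightarrow> boundary_ratio G (W i) \<le> ?h"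
    using kway_expansion_const_attained[of G k] assms by auto
  obtain f0 where f0: "f0 \<in> ?V \<rightarrow> {1..k}"
    and f0W: "\<And>i. i \<in> {1..k} \<Longrightarrow> part ?V f0 i = W i"
    using vertex_partition_obtains_label[OF W] by blast
  have W': "W i \<noteq> {}" "W i \<subseteq> ?V" if "i \<in> {1..k}" for i
    using W that by (auto simp: vertex_partition_def)
  have "0 \<le> boundary_ratio G (W 1)" by (simp add: boundary_ratio_def)
  then have h0: "0 \<le> ?h" using Wh[of 1] assms(2) by simp
  have power: "real (k + 1) \<le> 3 ^ k" "real (2 * k + 3) \<le> 3 ^ (k + 1)"
  proof -
    have "real (k + 1) \<le> real (3 ^ k)" using linear_le_power3[OF assms(2)] by (rule of_nat_mono)
    then show "real (k + 1) \<le> 3 ^ k" by simp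
    \<comment> \<open>Tripling the first bound gives
      \<open>3 * k + 3 \<le> 3 ^ (k + 1)\<close>.\<close>
    then show "real (2 * k + 3) \<le> 3 ^ (k + 1)" using assms(2) by simp
  qed
  have D: "real (2 * k + 3) * ?c \<le> ?D"
  proof -
    have "real (2 * k + 3) * ?c \<le> 3 ^ (k + 1) * ?c"
      using power(2) h0 assms(4) by (intro mult_right_mono) auto
    then show ?thesis by simp
  qed
  have start: "edges_between ?E (part ?V f0 i) (?V - part ?V f0 i) \<le> ?h * card (part ?V f0 i)"
    if i: "i \<in> {1..k}" for i
    using Wh[OF i] ratio[OF W'(2)[OF i]] cardpos[OF W'(2)[OF i] W'(1)[OF i]] f0W[OF i]
    by (simp add: divide_le_eq)
  have refine: "\<exists>i\<in>{1..k + 1}. ?D * card (part ?V g i) \<le> edges_between ?E (part ?V g i) (?V - part ?V g i)"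
    if g: "g \<in> ?V \<rightarrow> {1..k + 1}" "\<forall>i\<in>{1..k + 1}. part ?V g i \<noteq> {}" for g
  proof -
    obtain i where i: "i \<in> {1..k + 1}" "?D \<le> boundary_ratio G (part ?V g i)"
      using kway_expansion_const_le[OF _ _ vertex_partition_part[OF g]] by auto
    have "part ?V g i \<subseteq> ?V" by (auto simp: part_def)
    then show ?thesis
      using i g(2) ratio cardpos by (intro bexI[of _ i]) (auto simp: le_divide_eq)
  qed
  obtain f where f: "f \<in> ?V \<rightarrow> {1..k}" "\<And>i. i \<in> {1..k} \<Longrightarrow> part ?V f i \<noteq> {}"
    and bound: "\<And>i. i \<in> {1..k} \<Longrightarrow> edges_between ?E (part ?V f i) (?V - part ?V f i)
      \<le> real (k + 1) * ?h * card (part ?V f i)"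
    and expand: "\<And>i A. i \<in> {1..k} \<Longrightarrow> A \<subseteq> part ?V f i \<Longrightarrow> A \<noteq> {} \<Longrightarrow>
      2 * card A \<le> card (part ?V f i) \<Longrightarrow> ?c * card A \<le> edges_between ?E A (part ?V f i - A)"
  proof (rule R.expander_partition[OF h0 assms(4) D f0 _ start refine])
    show "part ?V f0 i \<noteq> {}" if "i \<in> {1..k}" for i
      using f0W[OF that] W'(1)[OF that] by simp
  qed blast+
  define H where "H i = G \<restriction> part ?V f i" for i
  have PV: "part ?V f i \<subseteq> ?V" for i by (auto simp: part_def)
  have vH: "verts (H i) = part ?V f i" for i by (simp add: H_def)
  have "graph_partition G k H"
    unfolding graph_partition_def vH
    using vertex_partition_part[OF f(1)] f(2) PV by (auto simp: H_def intro: induced_induce)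
  \<comment> \<open>In a one-vertex part no \<open>F\<close> qualifies and the infimum is
    \<open>\<infinity>\<close>; otherwise \<open>F\<close> is a set to which \<open>expand\<close>
    applies.\<close>
  moreover have "ereal ?c \<le> expansion_const (H i)" if i: "i \<in> {1..k}" for i
    unfolding expansion_const_def vH
  proof (rule INF_greatest, clarify)
    fix F assume F: "F \<subseteq> part ?V f i" "1 \<le> card F" "real (card F) \<le> real (card (part ?V f i)) / 2"
    have "?c * card F \<le> edges_between ?E F (part ?V f i - F)"
      using F by (intro expand[OF i]) auto
    also have "\<dots> = edges_between (arcs_ends (H i)) F (verts (H i) - F)"
      unfolding H_def arcs_ends_induce_subgraph using F(1)
      by (auto simp: edges_between_def intro!: arg_cong[where f = card])
    also have "\<dots> = real (card (edge_boundary (H i) F))"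
      using card_edge_boundary[of F "H i"] F(1) vH by simp
    finally show "ereal ?c \<le> ereal (boundary_ratio (H i) F)"
      using F(2) by (simp add: boundary_ratio_def le_divide_eq)
  qed
  moreover have "boundary_ratio G (verts (H i)) \<le> 3 ^ k * ?h" if i: "i \<in> {1..k}" for i
  proof -
    have "boundary_ratio G (verts (H i)) \<le> real (k + 1) * ?h"
      using bound[OF i] ratio[OF PV] cardpos[OF PV f(2)[OF i]] by (simp add: vH divide_le_eq)
    also have "\<dots> \<le> 3 ^ k * ?h" using power(1) h0 by (rule mult_right_mono)
    finally show ?thesis .
  qed
  ultimately have "graph_partition G k H \<and> ereal ?c \<le> (MIN i\<in>{1..k}. expansion_const (H i)) \<and>
      (MAX i\<in>{1..k}. boundary_ratio G (verts (H i))) \<le> 3 ^ k * ?h"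
    using assms(2) by (simp add: Max_le_iff Min_ge_iff)
  then show ?thesis by blast
qed

end
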